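(* Let $0<\alpha<\pi/2$, $\lambda_\alpha=4\sin^2\alpha$, and let $r\ge 0$ be an integer. Let $f(x)=\frac{\Gamma(x)^2}{2\Gamma(2x)}$ for $x>0$. Then the series $$T_r(\alpha)=\sum_{k=1}^{\infty}\lambda_\alpha^{k-1}(D+\log\lambda_\alpha)^r f(k)$$ converges absolutely and satisfies $$T_r(\alpha)=\frac{1}{\sin(2\alpha)}\left\{\alpha c_r-\sum_{j=1}^{r}2^{j-1}\binom{r}{j}c_{r-j}\operatorname{Ls}_{j+1}(2\alpha)\right\}.$$ Equivalently, the ordinary weighted derivative sums $S_r(\alpha)=\sum_{k=1}^{\infty}\lambda_\alpha^{k-1}f^{(r)}(k)$ are given by $$S_r(\alpha)=\sum_{j=0}^{r}\binom{r}{j}(-\log\lambda_\alpha)^{r-j}T_j(\alpha).$$ Moreover, for $r\ge2$ the coefficient $c_r$ is a polynomial in $\zeta(2),\ldots,\zeta(r)$, and $$c_r=\sum_{m=2}^{r}\binom{r-1}{m-1}(-1)^m(2-2^m)(m-1)!\,\zeta(m)\,c_{r-m}.$$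
   Context: $D$ denotes differentiation with respect to the argument of $f$, so $(D+\log\lambda)^r f(k)=\sum_{j=0}^r\binom{r}{j}(\log\lambda)^{r-j}f^{(j)}(k)$. The coefficients are $c_r=\left.\frac{d^r}{da^r}\frac{\Gamma(1+a)^2}{\Gamma(1+2a)}\right|_{a=0}$ for $r\ge0$ (so $c_0=1$, $c_1=0$). For $n\ge2$ and $0\le\phi\le2\pi$, the log-sine integral is $\operatorname{Ls}_n(\phi)=-\int_0^\phi\log^{n-1}\left(2\sin\frac{x}{2}\right)dx$. $\zeta$ is the Riemann zeta function. Empty sums are $0$. *)

theory Defs
  imports "HOL-Analysis.Analysis" "HOL-Library.Poly_Mapping"
begin

definition f :: "real \<Rightarrow> real" where
  "f x = (Gamma x)\<^sup>2 / (2 * Gamma (2 * x))"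

definition lam :: "real \<Rightarrow> real" where
  "lam \<alpha> = 4 * (sin \<alpha>)\<^sup>2"

definition D_plus_pow :: "real \<Rightarrow> nat \<Rightarrow> (real \<Rightarrow> real) \<Rightarrow> real \<Rightarrow> real" where
  "D_plus_pow b r g x = (\<Sum>j=0..r. real (r choose j) * b ^ (r - j) * (deriv ^^ j) g x)"

definition c :: "nat \<Rightarrow> real" where
  "c r = (deriv ^^ r) (\<lambda>a. (Gamma (1 + a))\<^sup>2 / Gamma (1 + 2 * a)) 0"

text \<open>The integrand is only singular at endpoints (where \<^term>\<open>ln 0 = (0::real)\<close> is a
  harmless convention on a null set); it is absolutely integrable, so the Henstock--Kurzweil
  integral is the usual one.  Meant for \<open>n \<ge> 2\<close> and \<open>0 \<le> \<phi> \<le> 2\<pi>\<close>.\<close>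

definition Ls :: "nat \<Rightarrow> real \<Rightarrow> real" where
  "Ls n \<phi> = - integral {0..\<phi>} (\<lambda>x. ln (2 * sin (x / 2)) ^ (n - 1))"

text \<open>The Riemann zeta function on real arguments \<open>s > 1\<close>, where it is given by its
  Dirichlet series.\<close>

definition zeta :: "real \<Rightarrow> real" where
  "zeta s = suminf (\<lambda>n. 1 / real (Suc n) powr s)"

text \<open>The series run over \<open>k \<ge> 1\<close>, hence the shift \<open>k + 1\<close> in the sums over \<open>k \<ge> 0\<close> below.\<close>

definition T_term :: "nat \<Rightarrow> real \<Rightarrow> nat \<Rightarrow> real" where
  "T_term r \<alpha> k = lam \<alpha> ^ (k - 1) * D_plus_pow (ln (lam \<alpha>)) r f (real k)"

definition T :: "nat \<Rightarrow> real \<Rightarrow> real" where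
  "T r \<alpha> = suminf (\<lambda>k. T_term r \<alpha> (k + 1))"

definition S_term :: "nat \<Rightarrow> real \<Rightarrow> nat \<Rightarrow> real" where
  "S_term r \<alpha> k = lam \<alpha> ^ (k - 1) * (deriv ^^ r) f (real k)"

definition S :: "nat \<Rightarrow> real \<Rightarrow> real" where
  "S r \<alpha> = suminf (\<lambda>k. S_term r \<alpha> (k + 1))"

text \<open>A polynomial with rational coefficients in variables indexed by \<^typ>\<open>nat\<close> is a finitely
  supported map from monomials (finitely supported exponent maps) to coefficients.\<close>

type_synonym rat_mpoly = "(nat \<Rightarrow>\<^sub>0 nat) \<Rightarrow>\<^sub>0 rat"

definition mpoly_vars :: "rat_mpoly \<Rightarrow> nat set" where
  "mpoly_vars p = (\<Union>m\<in>Poly_Mapping.keys p. Poly_Mapping.keys m)"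

definition mpoly_eval :: "(nat \<Rightarrow> real) \<Rightarrow> rat_mpoly \<Rightarrow> real" where
  "mpoly_eval x p = (\<Sum>m\<in>Poly_Mapping.keys p. of_rat (Poly_Mapping.lookup p m) * (\<Prod>i\<in>Poly_Mapping.keys m. x i ^ Poly_Mapping.lookup m i))"

end

theory Submission
  imports Defs
begin

text \<open>
  Write \<open>P\<^sub>j(z) = \<Sum>k\<ge>0. f\<^bsup>(j)\<^esup>(k+1) z\<^sup>k\<close>, so that \<open>T\<^sub>r\<close> is the binomial combination of the
  \<open>(ln \<lambda>)\<^bsup>r-j\<^esup> P\<^sub>j(\<lambda>)\<close>. The function \<open>C(x) = \<Gamma>(1+x)\<^sup>2/\<Gamma>(1+2x)\<close> equals both \<open>x f(x)\<close> and
  \<open>(4x+2) f(x+1)\<close>. Differentiating this \<open>j\<close> times gives a recurrence for the coefficients of \<open>P\<^sub>j\<close>,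
  which shows that the radius of convergence is at least 4 and amounts to the differential equation
  \<open>(2-z) P\<^sub>j + z(4-z) P\<^sub>j' + (4-z) j P\<^sub>j\<^sub>-\<^sub>1 = c\<^sub>j\<close>. Consequently
  \<open>sin(2\<alpha>) T\<^sub>r(\<alpha>)\<close> vanishes at \<open>0\<close> and has derivative \<open>\<Sum>j\<le>r. (r choose j) c\<^sub>j (ln \<lambda>\<^sub>\<alpha>)\<^bsup>r-j\<^esup>\<close>;
  integrating over \<open>[0,\<alpha>]\<close> yields the log-sine integrals. The recurrence for \<open>c\<^sub>r\<close> is Leibniz' rule
  applied to \<open>C' = C h\<close>, where the derivatives at \<open>0\<close> of the logarithmic derivative \<open>h\<close> are
  polygamma values at \<open>1\<close>.
\<close>

section \<open>Higher derivatives\<close>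

text \<open>Pascal's rule in summed form; it drives the induction step of Leibniz' rule in the next
  lemma.\<close>

lemma sum_binomial_Suc:
  fixes a :: "nat \<Rightarrow> real"
  shows "(\<Sum>i\<le>Suc n. real (Suc n choose i) * a i) = (\<Sum>i\<le>n. real (n choose i) * (a (Suc i) + a i))"
proof -
  have "(\<Sum>i\<le>n. real (n choose i) * a i) = (\<Sum>i\<le>Suc n. real (n choose i) * a i)"
    by simp
  also have "\<dots> = a 0 + (\<Sum>i\<le>n. real (n choose Suc i) * a (Suc i))"
    by (subst sum.atMost_Suc_shift) simp
  finally show ?thesis
    by (subst sum.atMost_Suc_shift) (simp add: algebra_simps sum.distrib)
qed

text \<open>\<open>h 0\<close> is the logarithmic derivative of \<open>g\<close> and
  \<open>h n\<close> its n-th derivative, so the formula is Leibniz' rule for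
  \<open>g' = g * h 0\<close>. Its right side involves only derivatives of \<open>g\<close> of lower
  order, which yields smoothness at the same time.\<close>

lemma higher_deriv_of_log_deriv:
  fixes g :: "real \<Rightarrow> real" and h :: "nat \<Rightarrow> real \<Rightarrow> real"
  assumes X: "open X"
    and g: "\<And>x. x \<in> X \<Longrightarrow> (g has_field_derivative g x * h 0 x) (at x)"
    and h: "\<And>n x. x \<in> X \<Longrightarrow> (h n has_field_derivative h (Suc n) x) (at x)"
    and x: "x \<in> X"
  shows "((deriv ^^ n) g has_field_derivative (deriv ^^ Suc n) g x) (at x)"
    and "(deriv ^^ Suc n) g x = (\<Sum>i\<le>n. real (n choose i) * ((deriv ^^ i) g x * h (n - i) x))"
proof -
  have "\<forall>x\<in>X. ((deriv ^^ n) g has_field_derivative (deriv ^^ Suc n) g x) (at x) \<and>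
      (deriv ^^ Suc n) g x = (\<Sum>i\<le>n. real (n choose i) * ((deriv ^^ i) g x * h (n - i) x))"
  proof (induction n rule: less_induct)
    case (less n)
    let ?R = "\<lambda>n x. \<Sum>i\<le>n. real (n choose i) * ((deriv ^^ i) g x * h (n - i) x)"
    have D: "((deriv ^^ n) g has_field_derivative ?R n x) (at x)" if x: "x \<in> X" for x
    proof (cases n)
      case 0
      then show ?thesis using g[OF x] by simp
    next
      case (Suc m)
      have IH: "((deriv ^^ i) g has_field_derivative (deriv ^^ Suc i) g x) (at x)" if "i \<le> m" for i
      proof -
        have "i < n" using that Suc by simp
        then show ?thesis using less.IH x by blast
      qed
      have "((\<lambda>x. ?R m x) has_field_derivative
          (\<Sum>i\<le>m. real (m choose i) *
            ((deriv ^^ Suc i) g x * h (m - i) x + h (Suc (m - i)) x * (deriv ^^ i) g x))) (at x)"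
        by (intro DERIV_sum DERIV_cmult DERIV_mult h[OF x] IH) simp
      also have "(\<Sum>i\<le>m. real (m choose i) *
            ((deriv ^^ Suc i) g x * h (m - i) x + h (Suc (m - i)) x * (deriv ^^ i) g x)) = ?R n x"
        unfolding Suc sum_binomial_Suc by (intro sum.cong) (auto simp: Suc_diff_le algebra_simps)
      finally show ?thesis
        by (rule has_field_derivative_transform_within_open[OF _ X x]) (use less.IH[of m] Suc in auto)
    qed
    then show ?case by (auto simp: DERIV_imp_deriv[OF D])
  qed
  then show "((deriv ^^ n) g has_field_derivative (deriv ^^ Suc n) g x) (at x)"
    and "(deriv ^^ Suc n) g x = (\<Sum>i\<le>n. real (n choose i) * ((deriv ^^ i) g x * h (n - i) x))"
    using x by blast+
qed

text \<open>A linear factor has no derivatives beyond the first, so Leibniz' rule keeps two terms.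
  The truncated \<open>n - 1\<close> at \<open>n = 0\<close> is harmless, since its factor
  \<open>real n\<close> vanishes.\<close>

lemma higher_deriv_linear_mult:
  fixes u v :: "real \<Rightarrow> real"
  assumes X: "open X"
    and v: "\<And>x. x \<in> X \<Longrightarrow> v x = (a + b * x) * u (x + d)"
    and u: "\<And>n x. x \<in> X \<Longrightarrow> ((deriv ^^ n) u has_field_derivative (deriv ^^ Suc n) u (x + d)) (at (x + d))"
    and x: "x \<in> X"
  shows "(deriv ^^ n) v x = (a + b * x) * (deriv ^^ n) u (x + d) + real n * b * (deriv ^^ (n - 1)) u (x + d)"
  using x
proof (induction n arbitrary: x)
  case 0
  then show ?case by (simp add: v)
next
  case (Suc n)
  have u': "((\<lambda>x. (deriv ^^ m) u (x + d)) has_field_derivative (deriv ^^ Suc m) u (x + d)) (at x)" for m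
    by (rule DERIV_shift[THEN iffD1, OF u[OF Suc.prems]])
  have "((\<lambda>x. (a + b * x) * (deriv ^^ n) u (x + d) + real n * b * (deriv ^^ (n - 1)) u (x + d))
     has_field_derivative ((a + b * x) * (deriv ^^ Suc n) u (x + d) + b * (deriv ^^ n) u (x + d)
       + real n * b * (deriv ^^ Suc (n - 1)) u (x + d))) (at x)"
    by (rule derivative_eq_intros u' refl)+ (simp add: algebra_simps)
  then have "((deriv ^^ n) v has_field_derivative ((a + b * x) * (deriv ^^ Suc n) u (x + d) + b * (deriv ^^ n) u (x + d)
       + real n * b * (deriv ^^ Suc (n - 1)) u (x + d))) (at x)"
    by (rule has_field_derivative_transform_within_open[OF _ X Suc.prems]) (simp add: Suc.IH)
  from DERIV_imp_deriv[OF this] show ?case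
    by (cases n) (simp_all add: algebra_simps)
qed

section \<open>Smoothness of \<open>f\<close> and the two representations of C\<close>

lemma pos_not_nonpos_Ints: "(0::real) < x \<Longrightarrow> x \<notin> \<int>\<^sub>\<le>\<^sub>0"
  by (auto elim!: nonpos_Ints_cases)

text \<open>The logarithmic derivative of \<open>f\<close> is
  \<open>2 * Digamma x - 2 * Digamma (2 * x)\<close>; each further differentiation of the second
  summand brings another factor 2.\<close>

lemma higher_deriv_f:
  assumes "0 < x"
  shows "((deriv ^^ n) f has_field_derivative (deriv ^^ Suc n) f x) (at x)"
proof (rule higher_deriv_of_log_deriv(1)[where X = "{0<..}"
      and h = "\<lambda>n x. 2 * Polygamma n x - 2 ^ Suc n * Polygamma n (2 * x)"])
  show "(f has_field_derivative f x * (2 * Digamma x - 2 ^ Suc 0 * Digamma (2 * x))) (at x)"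
    if "x \<in> {0<..}" for x :: real
  proof -
    have g: "Gamma (2 * x) \<noteq> 0" using that by (simp add: Gamma_eq_zero_iff pos_not_nonpos_Ints)
    show ?thesis
      unfolding f_def[abs_def] using that g
      by (auto intro!: derivative_eq_intros simp: pos_not_nonpos_Ints power2_eq_square field_simps)
  qed
  show "((\<lambda>x. 2 * Polygamma n x - 2 ^ Suc n * Polygamma n (2 * x)) has_field_derivative
      2 * Polygamma (Suc n) x - 2 ^ Suc (Suc n) * Polygamma (Suc n) (2 * x)) (at x)"
    if "x \<in> {0<..}" for x :: real and n
    using that by (auto intro!: derivative_eq_intros simp: pos_not_nonpos_Ints)
qed (use assms in auto)

text \<open>The function C of the overview. Unlike \<open>f\<close>, it is smooth at 0, the point
  where the coefficients \<open>c\<close> are read off.\<close>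

definition gamma_ratio :: "real \<Rightarrow> real" where
  "gamma_ratio a = (Gamma (1 + a))\<^sup>2 / Gamma (1 + 2 * a)"

lemma c_eq: "c n = (deriv ^^ n) gamma_ratio 0"
  by (simp add: c_def gamma_ratio_def[abs_def])

lemma gamma_ratio_higher_deriv:
  assumes "-1/2 < x"
  shows "(deriv ^^ Suc n) gamma_ratio x = (\<Sum>i\<le>n. real (n choose i) * ((deriv ^^ i) gamma_ratio x *
    (2 * Polygamma (n - i) (1 + x) - 2 ^ Suc (n - i) * Polygamma (n - i) (1 + 2 * x))))"
proof (rule higher_deriv_of_log_deriv(2)[where X = "{-1/2<..}"
      and h = "\<lambda>n x. 2 * Polygamma n (1 + x) - 2 ^ Suc n * Polygamma n (1 + 2 * x)"])
  show "(gamma_ratio has_field_derivative gamma_ratio x *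
      (2 * Digamma (1 + x) - 2 ^ Suc 0 * Digamma (1 + 2 * x))) (at x)"
    if "x \<in> {-1/2<..}" for x :: real
  proof -
    have g: "Gamma (1 + 2 * x) \<noteq> 0" using that by (simp add: Gamma_eq_zero_iff pos_not_nonpos_Ints)
    show ?thesis
      unfolding gamma_ratio_def[abs_def] using that g
      by (auto intro!: derivative_eq_intros simp: pos_not_nonpos_Ints power2_eq_square field_simps)
  qed
  show "((\<lambda>x. 2 * Polygamma n (1 + x) - 2 ^ Suc n * Polygamma n (1 + 2 * x)) has_field_derivative
      2 * Polygamma (Suc n) (1 + x) - 2 ^ Suc (Suc n) * Polygamma (Suc n) (1 + 2 * x)) (at x)"
    if "x \<in> {-1/2<..}" for x :: real and n
    using that by (auto intro!: derivative_eq_intros simp: pos_not_nonpos_Ints)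
qed (use assms in auto)

text \<open>The functional equation of Gamma at \<open>1 + 2 * x\<close>. This representation is
  valid at \<open>x = 0\<close> and so ties \<open>c\<close> to derivatives of \<open>f\<close> at
  1.\<close>

lemma gamma_ratio_eq_shift:
  assumes "-1/2 < x"
  shows "gamma_ratio x = (2 + 4 * x) * f (x + 1)"
proof -
  have "Gamma (2 * (x + 1)) = (1 + 2 * x) * Gamma (1 + 2 * x)"
    using Gamma_plus1[of "1 + 2 * x"] assms by (simp add: pos_not_nonpos_Ints algebra_simps)
  moreover have "1 + 2 * x \<noteq> 0" using assms by simp
  ultimately show ?thesis
    by (simp add: gamma_ratio_def f_def divide_simps add.commute)
qed

lemma gamma_ratio_eq:
  assumes "0 < x"
  shows "gamma_ratio x = x * f x"
proof -
  have "Gamma (1 + x) = x * Gamma x" "Gamma (1 + 2 * x) = 2 * x * Gamma (2 * x)"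
    using Gamma_plus1[of x] Gamma_plus1[of "2 * x"] assms
    by (simp_all add: pos_not_nonpos_Ints algebra_simps)
  then show ?thesis
    using assms by (simp add: gamma_ratio_def f_def power2_eq_square)
qed

lemma higher_deriv_gamma_ratio_shift:
  assumes "-1/2 < x"
  shows "(deriv ^^ n) gamma_ratio x = (2 + 4 * x) * (deriv ^^ n) f (x + 1) + real n * 4 * (deriv ^^ (n - 1)) f (x + 1)"
  by (rule higher_deriv_linear_mult[where X = "{-1/2<..}"])
    (use assms in \<open>auto simp: gamma_ratio_eq_shift simp del: funpow.simps intro!: higher_deriv_f\<close>)

lemma higher_deriv_gamma_ratio:
  assumes "0 < x"
  shows "(deriv ^^ n) gamma_ratio x = x * (deriv ^^ n) f x + real n * (deriv ^^ (n - 1)) f x"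
  using higher_deriv_linear_mult[of "{0<..}" gamma_ratio 0 1 f 0 x n] assms
  by (auto simp: gamma_ratio_eq higher_deriv_f simp del: funpow.simps)

section \<open>The power series of derivative values\<close>

definition f_coeff :: "nat \<Rightarrow> nat \<Rightarrow> real" where
  "f_coeff j k = (deriv ^^ j) f (real k + 1)"

lemma f_coeff_0: "2 * f_coeff j 0 + 4 * real j * f_coeff (j - 1) 0 = c j"
  using higher_deriv_gamma_ratio_shift[of 0 j] by (simp add: c_eq f_coeff_def)

text \<open>The j-th derivative of C at \<open>k + 1\<close> is expanded from both representations,
  and the two expansions are equated.\<close>

lemma f_coeff_Suc:
  "(4 * real (Suc k) + 2) * f_coeff j (Suc k) + 4 * real j * f_coeff (j - 1) (Suc k)
    = real (Suc k) * f_coeff j k + real j * f_coeff (j - 1) k"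
  using higher_deriv_gamma_ratio_shift[of "real k + 1" j] higher_deriv_gamma_ratio[of "real k + 1" j]
  by (simp add: f_coeff_def algebra_simps)

text \<open>By the recurrence, \<open>f_coeff j (Suc k)\<close> is
  \<open>(k + 1) / (4 * k + 6)\<close> times \<open>f_coeff j k\<close>, up to terms of derivative
  order \<open>j - 1\<close>. The factor is below 1/4 and those terms are bounded by induction on
  \<open>j\<close>, so every rate above 1/4 is reached.\<close>

lemma f_coeff_bound:
  assumes \<rho>: "1 / 4 < \<rho>"
  shows "\<exists>M\<ge>0. \<forall>k. \<bar>f_coeff j k\<bar> \<le> M * \<rho> ^ k"
proof (induction j)
  \<comment> \<open>\<open>M\<close> bounds the terms of derivative order \<open>j - 1\<close>; for
    \<open>j = 0\<close> their factor \<open>real j\<close> vanishes and \<open>M = 0\<close>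
    serves.\<close>
  have step: "\<exists>M\<ge>0. \<forall>k. \<bar>f_coeff j k\<bar> \<le> M * \<rho> ^ k"
    if M: "0 \<le> M" "\<And>k. real j * \<bar>f_coeff (j - 1) k\<bar> \<le> M * \<rho> ^ k" for j M
  proof -
    \<comment> \<open>\<open>E * \<rho> ^ k\<close> collects the bounds on the lower-order terms.
      \<open>N\<close> is large enough for the initial value and for
      \<open>N / 4 + E \<le> N * \<rho>\<close>, which carries the induction on
      \<open>k\<close>.\<close>
    define E where "E = M * (4 * \<rho> + 1)"
    define N where "N = \<bar>f_coeff j 0\<bar> + E / (\<rho> - 1 / 4)"
    have E: "E \<ge> 0" using M \<rho> by (simp add: E_def)
    have N: "N \<ge> 0" using E \<rho> by (simp add: N_def)
    have EN: "N / 4 + E \<le> N * \<rho>"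
    proof -
      have "E = E / (\<rho> - 1 / 4) * (\<rho> - 1 / 4)" using \<rho> by simp
      also have "\<dots> \<le> N * (\<rho> - 1 / 4)" by (rule mult_right_mono) (use \<rho> in \<open>auto simp: N_def\<close>)
      finally show ?thesis by (simp add: algebra_simps)
    qed
    have "\<bar>f_coeff j k\<bar> \<le> N * \<rho> ^ k" for k
    proof (induction k)
      case 0
      then show ?case using E \<rho> by (simp add: N_def)
    next
      case (Suc k)
      let ?d = "4 * real (Suc k) + 2"
      have "?d * \<bar>f_coeff j (Suc k)\<bar> = \<bar>?d * f_coeff j (Suc k)\<bar>"
        by (simp add: abs_mult)
      also have "\<dots> = \<bar>real (Suc k) * f_coeff j k + real j * f_coeff (j - 1) k
          - 4 * (real j * f_coeff (j - 1) (Suc k))\<bar>"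
        using f_coeff_Suc[of k j] by (simp add: algebra_simps)
      also have "\<dots> \<le> real (Suc k) * \<bar>f_coeff j k\<bar> + real j * \<bar>f_coeff (j - 1) k\<bar>
          + 4 * (real j * \<bar>f_coeff (j - 1) (Suc k)\<bar>)"
        by (rule order_trans[OF abs_triangle_ineq4], rule add_mono,
            rule order_trans[OF abs_triangle_ineq]) (simp_all add: abs_mult)
      also have "\<dots> \<le> real (Suc k) * \<bar>f_coeff j k\<bar> + M * \<rho> ^ k + 4 * (M * \<rho> ^ Suc k)"
        by (intro add_mono mult_left_mono M order_refl) auto
      also have "\<dots> = real (Suc k) * \<bar>f_coeff j k\<bar> + E * \<rho> ^ k"
        by (simp add: E_def algebra_simps)
      also have "\<dots> \<le> real (Suc k) * (N * \<rho> ^ k) + E * \<rho> ^ k"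
        by (intro add_right_mono mult_left_mono Suc.IH) auto
      also have "\<dots> \<le> ?d * ((N / 4 + E) * \<rho> ^ k)"
      proof -
        \<comment> \<open>This is the difference of the two sides, with
          \<open>?d = 4 * k + 6\<close>.\<close>
        have "0 \<le> (N / 2 + (4 * real k + 5) * E) * \<rho> ^ k"
          using N E \<rho> by (intro mult_nonneg_nonneg add_nonneg_nonneg) auto
        then show ?thesis by (simp add: field_simps)
      qed
      also have "\<dots> \<le> ?d * (N * \<rho> * \<rho> ^ k)"
        using \<rho> by (intro mult_left_mono mult_right_mono EN) auto
      finally show ?case by (simp add: mult_ac)
    qed
    then show ?thesis using N by blast
  qed
  case 0
  show ?case by (rule step[of 0]) auto
  case (Suc j)
  then obtain M where "0 \<le> M" "\<And>k. \<bar>f_coeff j k\<bar> \<le> M * \<rho> ^ k" by blast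
  then show ?case
    by (intro step[of "real (Suc j) * M"]) (auto simp: mult.assoc intro!: mult_left_mono)
qed

lemma summable_abs_f_coeff:
  assumes "\<bar>z\<bar> < 4"
  shows "summable (\<lambda>k. \<bar>f_coeff j k * z ^ k\<bar>)"
proof -
  \<comment> \<open>The reciprocal of the midpoint of |z| and 4, which lies above 1/4 and keeps the
    product with |z| below 1.\<close>
  define \<rho> where "\<rho> = 2 / (\<bar>z\<bar> + 4)"
  have \<rho>: "1 / 4 < \<rho>" "\<rho> * \<bar>z\<bar> < 1" "\<rho> > 0" using assms by (auto simp: \<rho>_def field_simps)
  obtain M where M: "\<And>k. \<bar>f_coeff j k\<bar> \<le> M * \<rho> ^ k" using f_coeff_bound[OF \<rho>(1)] by blast
  show ?thesis
  proof (rule summable_comparison_test')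
    show "summable (\<lambda>k. M * (\<rho> * \<bar>z\<bar>) ^ k)"
      using \<rho> by (intro summable_mult summable_geometric) (auto simp: abs_mult)
    show "norm \<bar>f_coeff j k * z ^ k\<bar> \<le> M * (\<rho> * \<bar>z\<bar>) ^ k" if "k \<ge> 0" for k
      using mult_right_mono[OF M[of k], of "\<bar>z\<bar> ^ k"]
      by (simp add: abs_mult power_abs power_mult_distrib mult_ac)
  qed
qed

lemma summable_f_coeff: "\<bar>z\<bar> < 4 \<Longrightarrow> summable (\<lambda>k. f_coeff j k * z ^ k)"
  by (rule summable_rabs_cancel[OF summable_abs_f_coeff])

definition f_series :: "nat \<Rightarrow> real \<Rightarrow> real" where
  "f_series j z = suminf (\<lambda>k. f_coeff j k * z ^ k)"

text \<open>The coefficient recurrence, read as an identity between generating functions.\<close>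

lemma f_series_ode:
  assumes z: "\<bar>z\<bar> < 4"
  obtains d where "(f_series j has_field_derivative d) (at z)"
    and "(2 - z) * f_series j z + z * (4 - z) * d + (4 - z) * (real j * f_series (j - 1) z) = c j"
proof
  let ?d = "suminf (\<lambda>k. diffs (f_coeff j) k * z ^ k)"
  show "(f_series j has_field_derivative ?d) (at z)"
    unfolding f_series_def[abs_def]
    by (rule termdiffs_strong'[where K = 4]) (use z summable_f_coeff in auto)
  have P: "(\<lambda>k. f_coeff i k * z ^ k) sums f_series i z" for i
    using summable_f_coeff[OF z] by (simp add: f_series_def summable_sums)
  have "summable (\<lambda>k. diffs (f_coeff j) k * z ^ k)"
    by (rule termdiff_converges[where K = 4]) (use z summable_f_coeff in auto)
  from sums_mult[OF diffs_equiv[OF this], of z]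
  have Q: "(\<lambda>k. real k * f_coeff j k * z ^ k) sums (z * ?d)"
    by (rule sums_cong[THEN iffD1, rotated]) (auto split: nat_diff_split simp: power_eq_if)
  \<comment> \<open>\<open>a\<close> and \<open>b\<close> are the two sides of the recurrence:
    \<open>a (Suc k) = b k\<close>, with \<open>a 0 = c j\<close>. Hence the generating function of
    \<open>a\<close> is \<open>c j\<close> plus \<open>z\<close> times that of \<open>b\<close>,
    which is the equation sought.\<close>
  define a where "a k = (4 * real k + 2) * f_coeff j k + 4 * real j * f_coeff (j - 1) k" for k
  define b where "b k = real (Suc k) * f_coeff j k + real j * f_coeff (j - 1) k" for k
  have A: "(\<lambda>k. a k * z ^ k) sums (4 * (z * ?d) + 2 * f_series j z + 4 * real j * f_series (j - 1) z)"
    using sums_add[OF sums_add[OF sums_mult[OF Q, of 4] sums_mult[OF P, of 2 j]]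
        sums_mult[OF P, of "4 * real j" "j - 1"]]
    by (simp add: a_def algebra_simps)
  have B: "(\<lambda>k. b k * z ^ k) sums (z * ?d + f_series j z + real j * f_series (j - 1) z)"
    using sums_add[OF sums_add[OF Q P[of j]] sums_mult[OF P, of "real j" "j - 1"]]
    by (simp add: b_def algebra_simps)
  have ab: "a (Suc k) = b k" for k
    using f_coeff_Suc[of k j] by (simp add: a_def b_def)
  have a0: "a 0 = c j"
    using f_coeff_0[of j] by (simp add: a_def)
  have "(\<lambda>k. a (Suc k) * z ^ Suc k) sums (z * (z * ?d + f_series j z + real j * f_series (j - 1) z))"
    using sums_mult[OF B, of z] by (simp add: ab mult_ac)
  then have "(\<lambda>k. a k * z ^ k) sums (z * (z * ?d + f_series j z + real j * f_series (j - 1) z) + c j)"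
    by (subst (asm) sums_Suc_iff) (simp add: a0)
  from sums_unique2[OF this A]
  show "(2 - z) * f_series j z + z * (4 - z) * ?d + (4 - z) * (real j * f_series (j - 1) z) = c j"
    by (simp add: algebra_simps)
qed

section \<open>The coefficients as polynomials in zeta values\<close>

text \<open>At 1 the series of \<open>Polygamma n\<close> is, up to sign and factorial, the
  Dirichlet series of zeta at \<open>n + 1\<close>.\<close>

lemma Polygamma_1:
  assumes "n > 0"
  shows "Polygamma n (1 :: real) = (-1) ^ Suc n * fact n * zeta (real (Suc n))"
proof -
  have "(\<lambda>k. inverse ((1 + real k) ^ Suc n)) sums ((-1) ^ Suc n * Polygamma n 1 / fact n)"
    by (rule Polygamma_LIMSEQ) (use assms in auto)
  moreover have "1 / real (Suc k) powr real (Suc n) = inverse ((1 + real k) ^ Suc n)" for k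
    by (subst powr_realpow) (simp_all add: inverse_eq_divide)
  ultimately have "zeta (real (Suc n)) = (-1) ^ Suc n * Polygamma n 1 / fact n"
    unfolding zeta_def by (simp only: sums_iff)
  then show ?thesis
    by (simp add: mult_ac flip: power_mult_distrib)
qed

section \<open>Evaluation of polynomials with rational coefficients\<close>

lemma mpoly_eval_superset:
  assumes "finite K" "Poly_Mapping.keys p \<subseteq> K"
  shows "mpoly_eval x p = (\<Sum>m\<in>K. of_rat (Poly_Mapping.lookup p m) *
    (\<Prod>i\<in>Poly_Mapping.keys m. x i ^ Poly_Mapping.lookup m i))"
  unfolding mpoly_eval_def using assms
  by (intro sum.mono_neutral_left) (auto simp: in_keys_iff)

lemma mpoly_eval_add: "mpoly_eval x (p + q) = mpoly_eval x p + mpoly_eval x q"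
proof -
  let ?K = "Poly_Mapping.keys p \<union> Poly_Mapping.keys q"
  show ?thesis
    using Poly_Mapping.keys_add[of p q]
    by (simp add: mpoly_eval_superset[of ?K] lookup_add of_rat_add algebra_simps sum.distrib)
qed

lemma mpoly_eval_single:
  "mpoly_eval x (Poly_Mapping.single m a) =
    of_rat a * (\<Prod>i\<in>Poly_Mapping.keys m. x i ^ Poly_Mapping.lookup m i)"
  by (simp add: mpoly_eval_superset[of "{m}"])

lemma monomial_eval_add:
  fixes x :: "nat \<Rightarrow> real" and m n :: "nat \<Rightarrow>\<^sub>0 nat"
  shows "(\<Prod>i\<in>Poly_Mapping.keys (m + n). x i ^ Poly_Mapping.lookup (m + n) i) =
    (\<Prod>i\<in>Poly_Mapping.keys m. x i ^ Poly_Mapping.lookup m i) *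
    (\<Prod>i\<in>Poly_Mapping.keys n. x i ^ Poly_Mapping.lookup n i)"
proof -
  let ?K = "Poly_Mapping.keys m \<union> Poly_Mapping.keys n"
  have *: "(\<Prod>i\<in>Poly_Mapping.keys k. x i ^ Poly_Mapping.lookup k i) = (\<Prod>i\<in>?K. x i ^ Poly_Mapping.lookup k i)"
    if "Poly_Mapping.keys k \<subseteq> ?K" for k
    using that by (intro prod.mono_neutral_left) (auto simp: in_keys_iff)
  show ?thesis
    unfolding *[OF Poly_Mapping.keys_add] *[OF Un_upper1] *[OF Un_upper2]
    by (simp add: lookup_add power_add prod.distrib)
qed

text \<open>Multiplication by one monomial suffices for the recurrence of \<open>c\<close>, where
  each summand carries a single zeta value. The induction builds \<open>p\<close> one monomial at a
  time.\<close>

lemma mpoly_eval_mult_single: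
  "mpoly_eval x (Poly_Mapping.single m a * p) = mpoly_eval x (Poly_Mapping.single m a) * mpoly_eval x p"
proof (induction p rule: update_induct)
  case const
  show ?case by (simp add: mpoly_eval_def)
next
  case (update p n b)
  \<comment> \<open>\<open>n\<close> is not in the support of \<open>p\<close>, so updating there
    amounts to adding a monomial.\<close>
  have u: "Poly_Mapping.update n b p = Poly_Mapping.single n b + p"
    using update(1) by (intro poly_mapping_eqI)
      (auto simp: lookup_add lookup_update lookup_single when_def in_keys_iff)
  show ?case
    unfolding u distrib_left mpoly_eval_add update.IH
    by (simp add: mult_single mpoly_eval_single monomial_eval_add of_rat_mult)
qed

lemma mpoly_vars_add: "mpoly_vars (p + q) \<subseteq> mpoly_vars p \<union> mpoly_vars q"
  using Poly_Mapping.keys_add[of p q] unfolding mpoly_vars_def by blast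

lemma mpoly_vars_mult: "mpoly_vars (p * q) \<subseteq> mpoly_vars p \<union> mpoly_vars q"
  using Poly_Mapping.keys_mult[of p q] Poly_Mapping.keys_add unfolding mpoly_vars_def by fastforce

text \<open>Working with attainable values instead of polynomials reduces the polynomiality of
  \<open>c r\<close> to closure properties.\<close>

definition rat_poly_values :: "(nat \<Rightarrow> real) \<Rightarrow> nat set \<Rightarrow> real set" where
  "rat_poly_values x A = {mpoly_eval x p | p. mpoly_vars p \<subseteq> A}"

lemma rat_poly_values_mono: "A \<subseteq> B \<Longrightarrow> rat_poly_values x A \<subseteq> rat_poly_values x B"
  unfolding rat_poly_values_def by blast

lemma rat_poly_values_of_rat: "of_rat q \<in> rat_poly_values x A"
  unfolding rat_poly_values_def
  by (rule CollectI, rule exI[of _ "Poly_Mapping.single 0 q"])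
    (auto simp: mpoly_eval_single mpoly_vars_def)

lemma rat_poly_values_add:
  "u \<in> rat_poly_values x A \<Longrightarrow> v \<in> rat_poly_values x A \<Longrightarrow> u + v \<in> rat_poly_values x A"
  unfolding rat_poly_values_def using mpoly_vars_add by (smt (verit) Un_least mem_Collect_eq mpoly_eval_add order_trans)

lemma rat_poly_values_sum:
  "(\<And>i. i \<in> I \<Longrightarrow> u i \<in> rat_poly_values x A) \<Longrightarrow> sum u I \<in> rat_poly_values x A"
  using rat_poly_values_of_rat[of 0]
  by (induction I rule: infinite_finite_induct) (auto intro: rat_poly_values_add)

text \<open>The shape of one summand in the recurrence for \<open>c\<close>: a rational number, a
  zeta value and an earlier coefficient.\<close>

lemma rat_poly_values_mult_var:
  assumes "i \<in> A" "v \<in> rat_poly_values x A"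
  shows "of_rat a * x i * v \<in> rat_poly_values x A"
proof -
  obtain p where p: "mpoly_vars p \<subseteq> A" "v = mpoly_eval x p"
    using assms(2) unfolding rat_poly_values_def by blast
  let ?q = "Poly_Mapping.single (Poly_Mapping.single i 1) a * p"
  have "mpoly_vars ?q \<subseteq> A"
  proof (rule order_trans[OF mpoly_vars_mult Un_least])
    show "mpoly_vars (Poly_Mapping.single (Poly_Mapping.single i 1) a) \<subseteq> A"
      using assms(1) by (auto simp: mpoly_vars_def)
  qed (rule p(1))
  moreover have "mpoly_eval x ?q = of_rat a * x i * v"
    by (simp add: mpoly_eval_mult_single mpoly_eval_single p(2))
  ultimately show ?thesis
    unfolding rat_poly_values_def by (intro CollectI exI[of _ ?q]) auto
qed

section \<open>The recurrence for the coefficients \<open>c\<close>\<close>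

lemma c_0: "c 0 = 1"
  by (simp add: c_def)

text \<open>Leibniz' rule for \<open>gamma_ratio\<close> at 0, with polygamma values at 1 replaced
  by zeta values. At \<open>r = 1\<close> the sum is empty, in accordance with
  \<open>c 1 = 0\<close>.\<close>

lemma c_recurrence:
  assumes "r > 0"
  shows "c r = (\<Sum>m=2..r. real ((r - 1) choose (m - 1)) * (- 1) ^ m * (2 - 2 ^ m) *
                  fact (m - 1) * zeta (real m) * c (r - m))"
proof -
  obtain n where r: "r = Suc n" using assms by (cases r) auto
  have "c r = (\<Sum>i\<le>n. real (n choose i) * (c i *
      (2 * Polygamma (n - i) 1 - 2 ^ Suc (n - i) * Polygamma (n - i) 1)))"
    using gamma_ratio_higher_deriv[of 0 n] by (simp add: r c_eq)
  also have "\<dots> = (\<Sum>m=1..r. real (n choose (r - m)) * (c (r - m) *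
      ((2 - 2 ^ m) * Polygamma (m - 1) 1)))"
    by (rule sum.reindex_bij_witness[of _ "\<lambda>m. r - m" "\<lambda>i. r - i"])
      (auto simp: r Suc_diff_le algebra_simps)
  \<comment> \<open>The term \<open>m = 1\<close> drops out because \<open>2 - 2 ^ 1 = 0\<close>;
    this removes \<open>Digamma 1\<close>, and with it Euler's constant.\<close>
  also have "\<dots> = (\<Sum>m=2..r. real (n choose (r - m)) * (c (r - m) *
      ((2 - 2 ^ m) * Polygamma (m - 1) 1)))"
    using assms by (subst sum.atLeast_Suc_atMost) (auto simp: numeral_2_eq_2)
  also have "\<dots> = (\<Sum>m=2..r. real ((r - 1) choose (m - 1)) * (- 1) ^ m * (2 - 2 ^ m) *
                  fact (m - 1) * zeta (real m) * c (r - m))"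
  proof (rule sum.cong[OF refl])
    fix m assume m: "m \<in> {2..r}"
    then have "n choose (r - m) = (r - 1) choose (m - 1)"
      by (subst binomial_symmetric) (auto simp: r)
    moreover have "Polygamma (m - 1) (1::real) = (-1) ^ m * fact (m - 1) * zeta (real m)"
      using Polygamma_1[of "m - 1"] m by simp
    ultimately show "real (n choose (r - m)) * (c (r - m) * ((2 - 2 ^ m) * Polygamma (m - 1) 1)) =
      real ((r - 1) choose (m - 1)) * (- 1) ^ m * (2 - 2 ^ m) * fact (m - 1) * zeta (real m) * c (r - m)"
      by simp
  qed
  finally show ?thesis .
qed

text \<open>Strong induction on the recurrence: the summand with index \<open>m\<close> involves the
  variable \<open>m\<close> and those of \<open>c (r - m)\<close>, all in
  \<open>{2..r}\<close>.\<close>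

lemma c_in_rat_poly_values: "c r \<in> rat_poly_values (\<lambda>m. zeta (real m)) {2..r}"
proof (induction r rule: less_induct)
  case (less r)
  show ?case
  proof (cases "r = 0")
    case True
    then show ?thesis using rat_poly_values_of_rat[of 1] by (simp add: c_0)
  next
    case False
    have fact: "of_rat (fact n) = (fact n :: real)" for n
      by (metis of_nat_fact of_rat_of_nat_eq)
    have "c r = (\<Sum>m=2..r. of_rat (of_nat ((r - 1) choose (m - 1)) * (- 1) ^ m * (2 - 2 ^ m) *
                  fact (m - 1)) * zeta (real m) * c (r - m))"
      unfolding c_recurrence[OF False[THEN neq0_conv[THEN iffD1]]]
      by (simp add: of_rat_mult of_rat_diff of_rat_power of_rat_minus fact)
    also have "\<dots> \<in> rat_poly_values (\<lambda>m. zeta (real m)) {2..r}"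
    proof (intro rat_poly_values_sum rat_poly_values_mult_var)
      fix m assume "m \<in> {2..r}"
      then show "c (r - m) \<in> rat_poly_values (\<lambda>m. zeta (real m)) {2..r}"
        using less.IH[of "r - m"] rat_poly_values_mono[of "{2..r - m}" "{2..r}"] by auto
    qed
    finally show ?thesis .
  qed
qed

section \<open>Integration in the angle\<close>

lemma lam_bounds:
  assumes "0 < \<alpha>" "\<alpha> < pi / 2"
  shows "0 < lam \<alpha>" "lam \<alpha> < 4"
proof -
  have "0 < sin \<alpha>" "0 < cos \<alpha>" using assms by (auto intro: sin_gt_zero cos_gt_zero)
  then have "0 < (sin \<alpha>)\<^sup>2" "0 < (cos \<alpha>)\<^sup>2" by simp_all
  then show "0 < lam \<alpha>" "lam \<alpha> < 4"
    using sin_squared_eq[of \<alpha>] by (simp_all add: lam_def)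
qed

lemma ln_lam:
  assumes "0 < sin y"
  shows "ln (lam y) = 2 * ln (2 * sin y)"
proof -
  have "lam y = (2 * sin y) ^ 2" by (simp add: lam_def power_mult_distrib)
  then have "ln (lam y) = ln ((2 * sin y) ^ 2)" by (rule arg_cong)
  also have "\<dots> = 2 * ln (2 * sin y)" using assms by (subst ln_realpow) auto
  finally show ?thesis .
qed

lemma lam_deriv: "(lam has_field_derivative 4 * sin (2 * y)) (at y)"
  unfolding lam_def[abs_def] by (auto intro!: derivative_eq_intros simp: sin_double)

text \<open>This is \<open>sin (2 * y) * T r y\<close> for \<open>0 < y < pi / 2\<close>, extended by \<open>0\<close> to \<open>y = 0\<close>, where the junk value
  \<open>ln 0\<close> is multiplied by \<open>sin 0\<close>.\<close>

definition T_primitive :: "nat \<Rightarrow> real \<Rightarrow> real" where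
  "T_primitive r y = sin (2 * y) *
    (\<Sum>j\<le>r. real (r choose j) * ln (lam y) ^ (r - j) * f_series j (lam y))"

text \<open>\<open>(r choose j) * (r - j) = (r choose (j + 1)) * (j + 1)\<close>, followed by an
  index shift. The left side arises from differentiating the powers of \<open>ln (lam y)\<close>;
  the right side matches the term of order \<open>j - 1\<close> in the differential equation.
  Truncated subtraction occurs only with factor 0.\<close>

lemma sum_binomial_shift:
  fixes a :: "nat \<Rightarrow> real"
  shows "(\<Sum>j\<le>r. real (r choose j) * (real (r - j) * L ^ (r - j - 1)) * a j)
    = (\<Sum>j\<le>r. real (r choose j) * L ^ (r - j) * (real j * a (j - 1)))"
proof (cases r)
  case (Suc s)
  have "(\<Sum>j\<le>r. real (r choose j) * (real (r - j) * L ^ (r - j - 1)) * a j)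
      = (\<Sum>j\<le>s. real (Suc s choose j) * (real (Suc s - j) * L ^ (s - j)) * a j)"
    by (simp add: Suc)
  also have "\<dots> = (\<Sum>j\<le>s. real (Suc s choose Suc j) * L ^ (s - j) * (real (Suc j) * a j))"
  proof (rule sum.cong[OF refl])
    fix j assume "j \<in> {..s}"
    have "real (Suc s choose j) * real (Suc s - j) = real (Suc s choose Suc j) * real (Suc j)"
      using binomial_absorb_comp[of "Suc s" j] Suc_times_binomial[of j s]
      by (simp only: diff_Suc_1 mult.commute flip: of_nat_mult)
    then show "real (Suc s choose j) * (real (Suc s - j) * L ^ (s - j)) * a j =
        real (Suc s choose Suc j) * L ^ (s - j) * (real (Suc j) * a j)"
      by (metis (no_types, lifting) mult.assoc mult.commute)
  qed
  also have "\<dots> = (\<Sum>j\<le>r. real (r choose j) * L ^ (r - j) * (real j * a (j - 1)))"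
    unfolding Suc by (simp add: sum.atMost_Suc_shift del: sum.atMost_Suc binomial_Suc_Suc)
  finally show ?thesis .
qed simp

text \<open>With \<open>z = lam y\<close>, the squared sine of \<open>2 * y\<close> is
  \<open>z * (4 - z) / 4\<close> and \<open>cos (2 * y) = 1 - z / 2\<close>. These turn the
  derivative into a binomial combination of the left sides of the differential equations for
  \<open>f_series j\<close>.\<close>

lemma T_primitive_deriv:
  assumes y: "0 < y" "y < pi / 2"
  shows "(T_primitive r has_field_derivative
    (\<Sum>j\<le>r. real (r choose j) * ln (lam y) ^ (r - j) * c j)) (at y)"
proof -
  define z where "z = lam y"
  define L where "L = ln z"
  have z: "0 < z" "z < 4" using lam_bounds[OF y] by (auto simp: z_def)
  then have z4: "\<bar>z\<bar> < 4" by simp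
  define P where "P j = f_series j z" for j
  have "\<exists>d. (f_series j has_field_derivative d) (at z) \<and>
      (2 - z) * P j + z * (4 - z) * d + (4 - z) * (real j * P (j - 1)) = c j" for j
    unfolding P_def using f_series_ode[OF z4] by blast
  then obtain d where d: "\<And>j. (f_series j has_field_derivative d j) (at z)"
    and ode: "\<And>j. (2 - z) * P j + z * (4 - z) * d j + (4 - z) * (real j * P (j - 1)) = c j"
    by metis
  have s2: "(sin (2 * y))\<^sup>2 = z * (4 - z) / 4"
  proof -
    have "(sin (2 * y))\<^sup>2 = 4 * (sin y)\<^sup>2 * (cos y)\<^sup>2"
      by (simp add: sin_double power_mult_distrib)
    then show ?thesis
      unfolding z_def lam_def cos_squared_eq by (simp add: algebra_simps)
  qed
  have c2: "cos (2 * y) = 1 - z / 2"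
    by (simp add: z_def lam_def cos_double_sin)
  have dL: "((\<lambda>y. ln (lam y)) has_field_derivative 4 * sin (2 * y) / z) (at y)"
    using DERIV_chain2[OF DERIV_ln lam_deriv, of y] z
    by (simp add: z_def divide_inverse mult.commute)
  have dP: "((\<lambda>y. f_series j (lam y)) has_field_derivative d j * (4 * sin (2 * y))) (at y)" for j
    by (rule DERIV_chain2[OF _ lam_deriv]) (use d z_def in auto)
  let ?s = "sin (2 * y)"
  have dsin: "((\<lambda>y. sin (2 * y)) has_field_derivative 2 * cos (2 * y)) (at y)"
    by (auto intro!: derivative_eq_intros)
  have dterm: "((\<lambda>y. b * ln (lam y) ^ n * f_series j (lam y)) has_field_derivative
      b * (real n * L ^ (n - 1) * (4 * ?s / z)) * P j + b * L ^ n * (d j * (4 * ?s))) (at y)" for b n j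
    using DERIV_mult[OF DERIV_cmult[OF DERIV_power[OF dL, of n], of b] dP[of j]]
    by (simp add: L_def z_def P_def mult_ac)
  have "(T_primitive r has_field_derivative
     ((\<Sum>j\<le>r. real (r choose j) * (real (r - j) * L ^ (r - j - 1) * (4 * ?s / z)) * P j
         + real (r choose j) * L ^ (r - j) * (d j * (4 * ?s))) * ?s
       + 2 * cos (2 * y) * (\<Sum>j\<le>r. real (r choose j) * L ^ (r - j) * P j))) (at y)"
    using DERIV_mult[OF dsin DERIV_sum[of "{..r}", OF dterm]]
    unfolding T_primitive_def[abs_def] L_def[symmetric] z_def[symmetric] P_def[symmetric]
    by (simp only: add.commute)
  also have "(\<Sum>j\<le>r. real (r choose j) * (real (r - j) * L ^ (r - j - 1) * (4 * ?s / z)) * P j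
         + real (r choose j) * L ^ (r - j) * (d j * (4 * ?s))) * ?s
       + 2 * cos (2 * y) * (\<Sum>j\<le>r. real (r choose j) * L ^ (r - j) * P j)
     = (4 * ?s\<^sup>2 / z) * (\<Sum>j\<le>r. real (r choose j) * (real (r - j) * L ^ (r - j - 1)) * P j)
       + (\<Sum>j\<le>r. real (r choose j) * L ^ (r - j) * (2 * cos (2 * y) * P j + 4 * ?s\<^sup>2 * d j))"
    by (simp add: sum.distrib distrib_left distrib_right sum_distrib_left sum_distrib_right
        power2_eq_square mult_ac del: of_nat_diff)
  also have "\<dots> = (4 - z) * (\<Sum>j\<le>r. real (r choose j) * L ^ (r - j) * (real j * P (j - 1)))
       + (\<Sum>j\<le>r. real (r choose j) * L ^ (r - j) * ((2 - z) * P j + z * (4 - z) * d j))"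
  proof -
    have "4 * ?s\<^sup>2 / z = 4 - z" "4 * ?s\<^sup>2 = z * (4 - z)" "2 * cos (2 * y) = 2 - z"
      unfolding s2 c2 using z by (simp_all add: field_simps)
    then show ?thesis by (simp only: sum_binomial_shift)
  qed
  also have "\<dots> = (\<Sum>j\<le>r. real (r choose j) * L ^ (r - j) * c j)"
    unfolding sum_distrib_left sum.distrib[symmetric] ode[symmetric]
    by (intro sum.cong refl) (simp add: algebra_simps)
  finally show ?thesis by (simp add: L_def z_def)
qed

text \<open>With \<open>u = - ln (2 * sin y)\<close> the function is
  \<open>cos y * (-2) ^ n * (u ^ n / exp u)\<close>, and \<open>u\<close> tends to infinity as
  \<open>y\<close> tends to 0 from the right.\<close>

lemma sin_mult_ln_lam_power_tendsto_0:
  "((\<lambda>y. sin (2 * y) * ln (lam y) ^ n) \<longlongrightarrow> 0) (at_right 0)"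
proof -
  have "((\<lambda>y. 2 * sin y) \<longlongrightarrow> 2 * sin (0::real)) (at_right 0)" by (intro tendsto_intros)
  moreover have pos: "eventually (\<lambda>y::real. sin y > 0) (at_right 0)"
    using eventually_at_right_real[OF pi_gt_zero] by eventually_elim (auto intro: sin_gt_zero)
  ultimately have "filterlim (\<lambda>y. 2 * sin y) (at_right 0) (at_right (0::real))"
    unfolding filterlim_at by (auto elim!: eventually_mono)
  from filterlim_compose[OF ln_at_0 this]
  have "filterlim (\<lambda>y::real. - ln (2 * sin y)) at_top (at_right 0)"
    by (simp only: filterlim_uminus_at_top minus_minus)
  from filterlim_compose[where g = "\<lambda>x. x ^ n / exp x", OF tendsto_power_div_exp_0 this]
  have *: "((\<lambda>y::real. cos y * (-2) ^ n * ((- ln (2 * sin y)) ^ n / exp (- ln (2 * sin y)))) \<longlongrightarrow>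
      cos 0 * (-2) ^ n * 0) (at_right 0)"
    by (intro tendsto_intros)
  have ev: "eventually (\<lambda>y::real. cos y * (-2) ^ n * ((- ln (2 * sin y)) ^ n / exp (- ln (2 * sin y)))
      = sin (2 * y) * ln (lam y) ^ n) (at_right 0)"
    using pos
  proof eventually_elim
    fix y :: real assume y: "0 < sin y"
    define u where "u = ln (2 * sin y)"
    have "exp u = 2 * sin y" using y by (simp add: u_def)
    moreover have "(-2) ^ n * (- u) ^ n = (2 * u) ^ n" by (subst power_mult_distrib[symmetric]) simp
    moreover have "cos y * (-2) ^ n * ((- u) ^ n / exp (- u)) = cos y * ((-2) ^ n * (- u) ^ n) * exp u"
      by (simp only: exp_minus divide_inverse inverse_inverse_eq mult.assoc)
    ultimately have "cos y * (-2) ^ n * ((- u) ^ n / exp (- u)) = cos y * (2 * u) ^ n * (2 * sin y)"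
      by (simp only:)
    also have "\<dots> = sin (2 * y) * ln (lam y) ^ n"
      unfolding ln_lam[OF y] u_def[symmetric] sin_double by (simp only: mult_ac)
    finally show "cos y * (-2) ^ n * ((- ln (2 * sin y)) ^ n / exp (- ln (2 * sin y)))
        = sin (2 * y) * ln (lam y) ^ n"
      unfolding u_def .
  qed
  show ?thesis
    using Lim_transform_eventually[OF * ev] by simp
qed

lemma T_primitive_0: "T_primitive r 0 = 0"
  by (simp add: T_primitive_def)

text \<open>Only the endpoint 0 needs an argument: there the sine factor absorbs the powers of the
  logarithm, and \<open>f_series j\<close> is continuous at \<open>lam 0 = 0\<close>.\<close>

lemma T_primitive_continuous:
  assumes \<alpha>: "0 < \<alpha>" "\<alpha> < pi / 2"
  shows "continuous_on {0..\<alpha>} (T_primitive r)"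
  unfolding continuous_on_eq_continuous_within
proof
  fix y assume y: "y \<in> {0..\<alpha>}"
  show "continuous (at y within {0..\<alpha>}) (T_primitive r)"
  proof (cases "y = 0")
    case False
    then have "isCont (T_primitive r) y"
      using y \<alpha> by (intro DERIV_isCont[OF T_primitive_deriv]) auto
    then show ?thesis by (rule continuous_at_imp_continuous_at_within)
  next
    case True
    have "((\<lambda>y. f_series j (lam y)) \<longlongrightarrow> f_series j (lam 0)) (at_right 0)" for j
    proof -
      obtain d where "(f_series j has_field_derivative d) (at (lam 0))"
        using f_series_ode[of "lam 0" j] by (auto simp: lam_def)
      then have "isCont (\<lambda>y. f_series j (lam y)) 0"
        by (rule isCont_o2[OF DERIV_isCont[OF lam_deriv] DERIV_isCont])
      then show ?thesis
        unfolding isCont_def by (rule tendsto_mono[rotated]) (simp add: at_le)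
    qed
    then have "((\<lambda>y. \<Sum>j\<le>r. real (r choose j) * (sin (2 * y) * ln (lam y) ^ (r - j)) * f_series j (lam y))
        \<longlongrightarrow> (\<Sum>j\<le>r. real (r choose j) * 0 * f_series j (lam 0))) (at_right 0)"
      by (intro tendsto_intros sin_mult_ln_lam_power_tendsto_0)
    then have "(T_primitive r \<longlongrightarrow> T_primitive r 0) (at_right 0)"
      by (simp add: T_primitive_def[abs_def] sum_distrib_left mult_ac)
    then show ?thesis
      using \<alpha> by (simp add: True continuous_within at_within_Icc_at_right)
  qed
qed

text \<open>The integrand may be singular at 0, hence the version of the fundamental theorem that
  asks for the derivative in the interior and for continuity up to the boundary.\<close>

lemma T_primitive_has_integral:
  assumes \<alpha>: "0 < \<alpha>" "\<alpha> < pi / 2"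
  shows "((\<lambda>y. \<Sum>j\<le>r. real (r choose j) * ln (lam y) ^ (r - j) * c j) has_integral T_primitive r \<alpha>) {0..\<alpha>}"
proof -
  have "((\<lambda>y. \<Sum>j\<le>r. real (r choose j) * ln (lam y) ^ (r - j) * c j) has_integral
      (T_primitive r \<alpha> - T_primitive r 0)) {0..\<alpha>}"
    by (rule fundamental_theorem_of_calculus_interior[OF _ T_primitive_continuous[OF \<alpha>]])
      (use \<alpha> in \<open>auto intro!: T_primitive_deriv simp flip: has_real_derivative_iff_has_vector_derivative\<close>)
  then show ?thesis by (simp add: T_primitive_0)
qed

text \<open>Since \<open>c 0 = 1\<close>, integrability of the powers of \<open>ln (lam y)\<close> follows by induction from
  that of the derivatives of \<^const>\<open>T_primitive\<close>.\<close>

lemma ln_lam_power_integrable: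
  assumes \<alpha>: "0 < \<alpha>" "\<alpha> < pi / 2"
  shows "(\<lambda>y. ln (lam y) ^ r) integrable_on {0..\<alpha>}"
proof (induction r rule: less_induct)
  case (less r)
  have eq: "(\<Sum>j\<le>r. real (r choose j) * ln (lam y) ^ (r - j) * c j)
      - (\<Sum>j=1..r. real (r choose j) * c j * ln (lam y) ^ (r - j)) = ln (lam y) ^ r" for y
    by (simp add: c_0 mult_ac atMost_atLeast0 sum.atLeast_Suc_atMost[of 0])
  have "(\<lambda>y. (\<Sum>j\<le>r. real (r choose j) * ln (lam y) ^ (r - j) * c j)
      - (\<Sum>j=1..r. real (r choose j) * c j * ln (lam y) ^ (r - j))) integrable_on {0..\<alpha>}"
    by (intro integrable_diff[OF has_integral_integrable[OF T_primitive_has_integral[OF \<alpha>]]]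
        integrable_sum integrable_on_mult_right less.IH) auto
  then show ?case unfolding eq .
qed

text \<open>Substitution \<open>x = 2 * y\<close>: the factor \<open>2 ^ n\<close> comes from
  \<open>ln_lam\<close>, one factor 2 is lost to the substitution, and the sign is that in the
  definition of \<open>Ls\<close>.\<close>

lemma integral_ln_lam_power:
  assumes \<alpha>: "0 < \<alpha>" "\<alpha> < pi / 2"
  shows "integral {0..\<alpha>} (\<lambda>y. ln (lam y) ^ n) =
    (if n = 0 then \<alpha> else - (2 ^ (n - 1) * Ls (n + 1) (2 * \<alpha>)))"
proof (cases "n = 0")
  case False
  \<comment> \<open>At \<open>y = 0\<close> both sides are 0 by the convention
    \<open>ln 0 = 0\<close>, so the integrands agree on the closed interval.\<close>
  have "ln (lam y) = 2 * ln (2 * sin y)" if "y \<in> {0..\<alpha>}" for y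
  proof (cases "y = 0")
    case False
    then have "0 < sin y" using that \<alpha> by (auto intro: sin_gt_zero)
    then show ?thesis by (rule ln_lam)
  qed (simp add: lam_def)
  then have "integral {0..\<alpha>} (\<lambda>y. ln (lam y) ^ n) = integral {0..\<alpha>} (\<lambda>y. 2 ^ n * ln (2 * sin y) ^ n)"
    by (intro integral_cong) (simp add: power_mult_distrib)
  also have "\<dots> = 2 ^ n * integral {0..\<alpha>} (\<lambda>y. ln (2 * sin y) ^ n)"
    by simp
  also have "integral {0..\<alpha>} (\<lambda>y. ln (2 * sin y) ^ n) =
      integral ((\<lambda>x. x / 2) ` {0..2 * \<alpha>}) (\<lambda>y. ln (2 * sin (2 * y / 2)) ^ n)"
    using \<alpha> by simp
  also have "\<dots> = integral {0..2 * \<alpha>} (\<lambda>x. ln (2 * sin (x / 2)) ^ n) / 2"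
    using integral_stretch_real[of 2 0 "2 * \<alpha>" "\<lambda>x. ln (2 * sin (x / 2)) ^ n"] by simp
  finally show ?thesis using False by (cases n) (simp_all add: Ls_def)
qed (use \<alpha> in simp)

lemma T_primitive_eq:
  assumes \<alpha>: "0 < \<alpha>" "\<alpha> < pi / 2"
  shows "T_primitive r \<alpha> =
    \<alpha> * c r - (\<Sum>j=1..r. 2 ^ (j - 1) * real (r choose j) * c (r - j) * Ls (j + 1) (2 * \<alpha>))"
proof -
  have "T_primitive r \<alpha> = integral {0..\<alpha>} (\<lambda>y. \<Sum>j\<le>r. real (r choose j) * ln (lam y) ^ (r - j) * c j)"
    using T_primitive_has_integral[OF \<alpha>] by (simp add: has_integral_iff)
  \<comment> \<open>The index is reversed so that \<open>j\<close> becomes the exponent of the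
    logarithm; its term \<open>j = 0\<close> will give \<open>\<alpha> * c r\<close>.\<close>
  also have "\<dots> = integral {0..\<alpha>} (\<lambda>y. \<Sum>j\<le>r. real (r choose j) * c (r - j) * ln (lam y) ^ j)"
    by (subst sum.nat_diff_reindex[symmetric, of _ "Suc r", unfolded lessThan_Suc_atMost])
      (simp add: binomial_symmetric[symmetric] mult_ac)
  also have "\<dots> = (\<Sum>j\<le>r. real (r choose j) * c (r - j) * integral {0..\<alpha>} (\<lambda>y. ln (lam y) ^ j))"
    by (subst integral_sum) (auto intro!: integrable_on_mult_right ln_lam_power_integrable[OF \<alpha>])
  also have "\<dots> = \<alpha> * c r + (\<Sum>j=1..r. real (r choose j) * c (r - j) * integral {0..\<alpha>} (\<lambda>y. ln (lam y) ^ j))"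
    using \<alpha> by (simp add: atMost_atLeast0 sum.atLeast_Suc_atMost[of 0])
  finally show ?thesis
    by (simp add: integral_ln_lam_power[OF \<alpha>] sum_negf mult_ac)
qed

section \<open>The series \<open>T\<close> and \<open>S\<close>\<close>

lemma T_term_Suc:
  "T_term r \<alpha> (k + 1) = (\<Sum>j\<le>r. real (r choose j) * ln (lam \<alpha>) ^ (r - j) * (f_coeff j k * lam \<alpha> ^ k))"
  by (simp add: T_term_def D_plus_pow_def f_coeff_def sum_distrib_left atMost_atLeast0 mult_ac add_ac)

lemma S_term_Suc: "S_term r \<alpha> (k + 1) = f_coeff r k * lam \<alpha> ^ k"
  by (simp add: S_term_def f_coeff_def mult_ac add_ac)

lemma T_eq:
  assumes "\<bar>lam \<alpha>\<bar> < 4"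
  shows "T r \<alpha> = (\<Sum>j\<le>r. real (r choose j) * ln (lam \<alpha>) ^ (r - j) * f_series j (lam \<alpha>))"
  unfolding T_def T_term_Suc f_series_def
  by (subst suminf_sum) (auto simp: suminf_mult summable_f_coeff[OF assms] intro!: summable_mult summable_f_coeff assms)

lemma T_term_abs_summable:
  assumes "\<bar>lam \<alpha>\<bar> < 4"
  shows "summable (\<lambda>k. \<bar>T_term r \<alpha> (k + 1)\<bar>)"
proof (rule summable_comparison_test')
  show "summable (\<lambda>k. \<Sum>j\<le>r. \<bar>real (r choose j) * ln (lam \<alpha>) ^ (r - j)\<bar> * \<bar>f_coeff j k * lam \<alpha> ^ k\<bar>)"
    by (intro summable_sum summable_mult summable_abs_f_coeff assms)
  show "norm \<bar>T_term r \<alpha> (k + 1)\<bar>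
      \<le> (\<Sum>j\<le>r. \<bar>real (r choose j) * ln (lam \<alpha>) ^ (r - j)\<bar> * \<bar>f_coeff j k * lam \<alpha> ^ k\<bar>)" if "k \<ge> 0" for k
    unfolding T_term_Suc abs_mult[symmetric] real_norm_def abs_idempotent by (rule sum_abs)
qed

text \<open>Binomial inversion, reflecting \<open>D = (D + L) - L\<close>. After exchanging the
  sums, the inner one is a multiple of \<open>(L - L) ^ (r - i)\<close> by the binomial theorem,
  which leaves only \<open>i = r\<close>.\<close>

lemma binomial_shift_inverse:
  fixes a :: "nat \<Rightarrow> real"
  shows "(\<Sum>j\<le>r. real (r choose j) * (- L) ^ (r - j) * (\<Sum>i\<le>j. real (j choose i) * L ^ (j - i) * a i)) = a r"
proof -
  have "(\<Sum>j\<le>r. real (r choose j) * (- L) ^ (r - j) * (\<Sum>i\<le>j. real (j choose i) * L ^ (j - i) * a i))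
      = (\<Sum>j\<le>r. \<Sum>i\<le>j. real (r choose j) * (- L) ^ (r - j) * (real (j choose i) * L ^ (j - i) * a i))"
    by (simp add: sum_distrib_left)
  also have "\<dots> = (\<Sum>i\<le>r. \<Sum>j=i..r. real (r choose j) * (- L) ^ (r - j) * (real (j choose i) * L ^ (j - i) * a i))"
    unfolding sum.Sigma[OF finite_atMost ballI[OF finite_atMost]]
      sum.Sigma[OF finite_atMost ballI[OF finite_atLeastAtMost]]
    by (rule sum.reindex_bij_witness[of _ prod.swap prod.swap]) auto
  also have "\<dots> = (\<Sum>i\<le>r. real (r choose i) * a i * 0 ^ (r - i))"
  proof (rule sum.cong[OF refl])
    fix i assume i: "i \<in> {..r}"
    have "(\<Sum>j=i..r. real (r choose j) * (- L) ^ (r - j) * (real (j choose i) * L ^ (j - i) * a i))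
        = (\<Sum>k\<le>r - i. real (r choose i) * a i * (real ((r - i) choose k) * L ^ k * (- L) ^ (r - i - k)))"
    proof (rule sum.reindex_bij_witness[of _ "\<lambda>k. k + i" "\<lambda>j. j - i"])
      fix j assume j: "j \<in> {i..r}"
      then have "real (r choose j) * real (j choose i) = real (r choose i) * real ((r - i) choose (j - i))"
        using choose_mult[of i j r] by (simp flip: of_nat_mult)
      moreover have "r - i - (j - i) = r - j" using j by simp
      ultimately show "real (r choose i) * a i * (real ((r - i) choose (j - i)) * L ^ (j - i) * (- L) ^ (r - i - (j - i)))
          = real (r choose j) * (- L) ^ (r - j) * (real (j choose i) * L ^ (j - i) * a i)"
        by (simp add: mult_ac)
    qed (use i in auto)
    also have "\<dots> = real (r choose i) * a i * (L + - L) ^ (r - i)"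
      unfolding binomial_ring by (simp add: sum_distrib_left)
    finally show "(\<Sum>j=i..r. real (r choose j) * (- L) ^ (r - j) * (real (j choose i) * L ^ (j - i) * a i))
        = real (r choose i) * a i * 0 ^ (r - i)" by simp
  qed
  also have "\<dots> = (\<Sum>i\<le>r. if i = r then a i else 0)"
    by (intro sum.cong) (auto simp: power_0_left)
  finally show ?thesis by simp
qed

theorem theorem1p1:
  fixes \<alpha> :: real and r :: nat
  assumes "0 < \<alpha>" and "\<alpha> < pi / 2"
  shows "summable (\<lambda>k. \<bar>T_term r \<alpha> (k + 1)\<bar>)
    \<and> T r \<alpha> = 1 / sin (2 * \<alpha>) *
        (\<alpha> * c r - (\<Sum>j=1..r. 2 ^ (j - 1) * real (r choose j) * c (r - j) * Ls (j + 1) (2 * \<alpha>)))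
    \<and> summable (\<lambda>k. S_term r \<alpha> (k + 1))
    \<and> S r \<alpha> = (\<Sum>j=0..r. real (r choose j) * (- ln (lam \<alpha>)) ^ (r - j) * T j \<alpha>)
    \<and> (2 \<le> r \<longrightarrow>
        (\<exists>p :: rat_mpoly. mpoly_vars p \<subseteq> {2..r} \<and> c r = mpoly_eval (\<lambda>m. zeta (real m)) p)
      \<and> c r = (\<Sum>m=2..r. real ((r - 1) choose (m - 1)) * (- 1) ^ m * (2 - 2 ^ m) *
                  fact (m - 1) * zeta (real m) * c (r - m)))"
proof (intro conjI impI)
  have lam: "\<bar>lam \<alpha>\<bar> < 4" using lam_bounds[OF assms] by simp
  show "summable (\<lambda>k. \<bar>T_term r \<alpha> (k + 1)\<bar>)"
    by (rule T_term_abs_summable[OF lam])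
  have "sin (2 * \<alpha>) > 0" using assms by (intro sin_gt_zero) auto
  then show "T r \<alpha> = 1 / sin (2 * \<alpha>) *
        (\<alpha> * c r - (\<Sum>j=1..r. 2 ^ (j - 1) * real (r choose j) * c (r - j) * Ls (j + 1) (2 * \<alpha>)))"
    unfolding T_primitive_eq[OF assms, symmetric] by (simp add: T_primitive_def T_eq[OF lam])
  show "summable (\<lambda>k. S_term r \<alpha> (k + 1))"
    unfolding S_term_Suc by (rule summable_f_coeff[OF lam])
  \<comment> \<open>The \<open>T j\<close> are binomial transforms of the \<open>f_series\<close>
    values, so inversion recovers the plain series.\<close>
  have "S r \<alpha> = f_series r (lam \<alpha>)"
    by (simp only: S_def S_term_Suc f_series_def)
  then show "S r \<alpha> = (\<Sum>j=0..r. real (r choose j) * (- ln (lam \<alpha>)) ^ (r - j) * T j \<alpha>)"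
    by (simp add: T_eq[OF lam] binomial_shift_inverse atLeast0AtMost)
  assume r: "2 \<le> r"
  show "\<exists>p :: rat_mpoly. mpoly_vars p \<subseteq> {2..r} \<and> c r = mpoly_eval (\<lambda>m. zeta (real m)) p"
    using c_in_rat_poly_values[of r] unfolding rat_poly_values_def by blast
  show "c r = (\<Sum>m=2..r. real ((r - 1) choose (m - 1)) * (- 1) ^ m * (2 - 2 ^ m) *
                  fact (m - 1) * zeta (real m) * c (r - m))"
    by (rule c_recurrence) (use r in simp)
qed

end
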